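(* Let $c$ be a non-negative integer and let $G$ be a (nilpotent of class $c$)-by-abelian group. Then the group $\mathrm{Aut_n}(G)$ of all normal automorphisms of $G$ is (nilpotent of class $\leq c$)-by-metabelian; that is, $\mathrm{Aut_n}(G)$ has a normal subgroup $N$ which is nilpotent of class at most $c$ and such that $\mathrm{Aut_n}(G)/N$ is metabelian.
   Context: An automorphism $\varphi$ of a group $G$ is called normal if $\varphi(H)=H$ for every normal subgroup $H$ of $G$. The normal automorphisms of $G$ form a normal subgroup $\mathrm{Aut_n}(G)$ of the automorphism group $\mathrm{Aut}(G)$. For group properties $\mathcal{P}$ and $\mathcal{Q}$, a group is $\mathcal{P}$-by-$\mathcal{Q}$ if it has a normal subgroup with property $\mathcal{P}$ whose quotient has property $\mathcal{Q}$. A group is metabelian if it is soluble of derived length at most $2$. Groups are not assumed finite. *)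

theory Defs
  imports "HOL-Algebra.Algebra"
begin

definition normal_auto :: "('a, 'b) monoid_scheme \<Rightarrow> ('a \<Rightarrow> 'a) set"
  where "normal_auto G = {\<phi> \<in> auto G. \<forall>H. H \<lhd> G \<longrightarrow> \<phi> ` H = H}"

definition NormalAutoGroup :: "('a, 'b) monoid_scheme \<Rightarrow> ('a \<Rightarrow> 'a) monoid"
  where "NormalAutoGroup G = (AutoGroup G)\<lparr>carrier := normal_auto G\<rparr>"

text \<open>The lower central series, indexed from 0, with the commutator convention of
  \<^const>\<open>derived\<close>: \<open>lower_central G n\<close> is the term usually written
  \<open>\<gamma>\<close> with index \<open>n + 1\<close>, so that the class is the first index of a trivial term.\<close>

primrec lower_central :: "('a, 'b) monoid_scheme \<Rightarrow> nat \<Rightarrow> 'a set" where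
  "lower_central G 0 = carrier G"
| "lower_central G (Suc n) = generate G
     (\<Union>x \<in> lower_central G n. \<Union>y \<in> carrier G.
        {x \<otimes>\<^bsub>G\<^esub> y \<otimes>\<^bsub>G\<^esub> inv\<^bsub>G\<^esub> x \<otimes>\<^bsub>G\<^esub> inv\<^bsub>G\<^esub> y})"

definition nilpotent_group :: "('a, 'b) monoid_scheme \<Rightarrow> bool"
  where "nilpotent_group G \<longleftrightarrow> group G \<and> (\<exists>n. lower_central G n = {\<one>\<^bsub>G\<^esub>})"

text \<open>Meaningful for nilpotent groups only; likewise \<open>derived_length\<close> below for soluble groups only.\<close>

definition nilpotency_class :: "('a, 'b) monoid_scheme \<Rightarrow> nat"
  where "nilpotency_class G = (LEAST n. lower_central G n = {\<one>\<^bsub>G\<^esub>})"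

definition derived_length :: "('a, 'b) monoid_scheme \<Rightarrow> nat"
  where "derived_length G = (LEAST n. (derived G ^^ n) (carrier G) = {\<one>\<^bsub>G\<^esub>})"

definition metabelian :: "('a, 'b) monoid_scheme \<Rightarrow> bool"
  where "metabelian G \<longleftrightarrow> group G \<and> solvable G \<and> derived_length G \<le> 2"

text \<open>\<open>P\<close>-by-\<open>Q\<close>: the normal subgroup has \<open>P\<close> and the quotient has \<open>Q\<close>.\<close>

definition by_group ::
    "(('a, 'b) monoid_scheme \<Rightarrow> bool) \<Rightarrow> ('a set monoid \<Rightarrow> bool) \<Rightarrow> ('a, 'b) monoid_scheme \<Rightarrow> bool"
  where "by_group P Q G \<longleftrightarrow>
    group G \<and> (\<exists>N. N \<lhd> G \<and> P (G\<lparr>carrier := N\<rparr>) \<and> Q (G Mod N))"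

lemma (in group) normal_image_auto:
  assumes f: "f \<in> auto G" and H: "H \<lhd> G"
  shows "f ` H \<lhd> G"
proof -
  have bij: "bij_betw f (carrier G) (carrier G)" and hom: "f \<in> hom G G"
    using f by (auto simp: auto_def Bij_def)
  interpret f: group_hom G G f
    using hom by (simp add: group_hom.intro group_hom_axioms.intro is_group)
  interpret H: normal H G by fact
  have sub: "subgroup (f ` H) G"
    by (rule f.subgroup_img_is_subgroup) (rule H.is_subgroup)
  show ?thesis
  proof (rule normal_invI[OF sub])
    fix x h assume x: "x \<in> carrier G" and h: "h \<in> f ` H"
    obtain y where y: "y \<in> carrier G" "x = f y" using bij x by (auto simp: bij_betw_def)
    obtain k where k: "k \<in> H" "h = f k" using h by auto
    have kc: "k \<in> carrier G" using k H.subset by auto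
    have "x \<otimes> h \<otimes> inv x = f (y \<otimes> k \<otimes> inv y)" using y k kc by simp
    moreover have "y \<otimes> k \<otimes> inv y \<in> H" using H.inv_op_closed2 y k by blast
    ultimately show "x \<otimes> h \<otimes> inv x \<in> f ` H" by blast
  qed
qed

lemma (in group) inv_AutoGroup:
  assumes f: "f \<in> auto G"
  shows "inv\<^bsub>AutoGroup G\<^esub> f = (\<lambda>x \<in> carrier G. inv_into (carrier G) f x)"
proof -
  have "inv\<^bsub>AutoGroup G\<^esub> f = inv\<^bsub>BijGroup (carrier G)\<^esub> f"
    unfolding AutoGroup_def
    using group.m_inv_consistent[OF group_BijGroup subgroup_auto f] by simp
  then show ?thesis using f inv_BijGroup by (auto simp: auto_def)
qed

lemma (in group) normal_auto_normal: "normal_auto G \<lhd> AutoGroup G"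
proof -
  let ?A = "AutoGroup G" and ?C = "carrier G"
  interpret A: group ?A by (rule AutoGroup)
  have cA: "carrier ?A = auto G" by (simp add: AutoGroup_def)
  have mA: "(f \<otimes>\<^bsub>?A\<^esub> g) ` H = f ` g ` H"
    if "f \<in> auto G" "g \<in> auto G" "H \<subseteq> ?C" for f g H
  proof -
    have "f \<otimes>\<^bsub>?A\<^esub> g = compose ?C f g"
      using that by (simp add: AutoGroup_def BijGroup_def auto_def)
    then show ?thesis using that(3) by (auto simp: compose_def image_iff subset_iff)
  qed
  have oA: "\<one>\<^bsub>?A\<^esub> ` H = H" if "H \<subseteq> ?C" for H
    using that by (auto simp: AutoGroup_def BijGroup_def subset_iff image_iff)
  have nsub: "H \<subseteq> ?C" if "H \<lhd> G" for H
    using that normal_imp_subgroup subgroup.subset by blast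
  have sub: "subgroup (normal_auto G) ?A"
  proof (rule A.subgroupI)
    show "normal_auto G \<subseteq> carrier ?A" by (auto simp: cA normal_auto_def)
    have "\<one>\<^bsub>?A\<^esub> \<in> normal_auto G"
      using A.one_closed oA nsub by (simp add: cA normal_auto_def)
    then show "normal_auto G \<noteq> {}" by blast
  next
    fix f assume f: "f \<in> normal_auto G"
    then have fa: "f \<in> auto G" and fi: "\<And>H. H \<lhd> G \<Longrightarrow> f ` H = H"
      by (auto simp: normal_auto_def)
    have ia: "inv\<^bsub>?A\<^esub> f \<in> auto G" using A.inv_closed fa cA by auto
    have "(inv\<^bsub>?A\<^esub> f) ` H = H" if "H \<lhd> G" for H
    proof -
      have "(inv\<^bsub>?A\<^esub> f) ` f ` H = (inv\<^bsub>?A\<^esub> f \<otimes>\<^bsub>?A\<^esub> f) ` H"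
        using mA[OF ia fa nsub[OF that]] by simp
      also have "\<dots> = H" using fa cA oA nsub that by simp
      finally show ?thesis using fi[OF that] by simp
    qed
    then show "inv\<^bsub>?A\<^esub> f \<in> normal_auto G" using ia by (auto simp: normal_auto_def)
  next
    fix f g assume fg: "f \<in> normal_auto G" "g \<in> normal_auto G"
    then have a: "f \<in> auto G" "g \<in> auto G" by (auto simp: normal_auto_def)
    have "f \<otimes>\<^bsub>?A\<^esub> g \<in> auto G" using A.m_closed a cA by auto
    then show "f \<otimes>\<^bsub>?A\<^esub> g \<in> normal_auto G"
      using fg mA[OF a] nsub by (auto simp: normal_auto_def)
  qed
  show ?thesis
  proof (rule A.normal_invI[OF sub])
    fix g f assume g: "g \<in> carrier ?A" and f: "f \<in> normal_auto G"
    have fa: "f \<in> auto G" and fi: "\<And>H. H \<lhd> G \<Longrightarrow> f ` H = H"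
      using f by (auto simp: normal_auto_def)
    have ga: "g \<in> auto G" and ia: "inv\<^bsub>?A\<^esub> g \<in> auto G"
      using g A.inv_closed cA by auto
    have gf: "g \<otimes>\<^bsub>?A\<^esub> f \<in> auto G" using A.m_closed ga fa cA by auto
    have ca: "g \<otimes>\<^bsub>?A\<^esub> f \<otimes>\<^bsub>?A\<^esub> inv\<^bsub>?A\<^esub> g \<in> auto G" using A.m_closed gf ia cA by auto
    have "(g \<otimes>\<^bsub>?A\<^esub> f \<otimes>\<^bsub>?A\<^esub> inv\<^bsub>?A\<^esub> g) ` H = H" if H: "H \<lhd> G" for H
    proof -
      let ?K = "(inv\<^bsub>?A\<^esub> g) ` H"
      have K: "?K \<lhd> G" by (rule normal_image_auto[OF ia H])
      have "(g \<otimes>\<^bsub>?A\<^esub> f \<otimes>\<^bsub>?A\<^esub> inv\<^bsub>?A\<^esub> g) ` H = g ` f ` ?K"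
        using mA[OF gf ia nsub[OF H]] mA[OF ga fa nsub[OF K]] by simp
      also have "\<dots> = g ` ?K" using fi[OF K] by simp
      also have "\<dots> = (g \<otimes>\<^bsub>?A\<^esub> inv\<^bsub>?A\<^esub> g) ` H" using mA[OF ga ia nsub[OF H]] by simp
      also have "\<dots> = H" using g oA nsub H by simp
      finally show ?thesis .
    qed
    then show "g \<otimes>\<^bsub>?A\<^esub> f \<otimes>\<^bsub>?A\<^esub> inv\<^bsub>?A\<^esub> g \<in> normal_auto G"
      using ca by (auto simp: normal_auto_def)
  qed
qed

lemma (in group) group_NormalAutoGroup: "group (NormalAutoGroup G)"
  unfolding NormalAutoGroup_def
  using subgroup.subgroup_is_group[OF normal_imp_subgroup[OF normal_auto_normal] AutoGroup] .

end

theory Submission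
  imports Defs
begin

text \<open>Let \<open>K\<close> be a nilpotent normal subgroup of class \<open>c\<close> with \<open>G/K\<close> abelian, and write \<open>A\<close> for
  the group of normal automorphisms. The series \<open>H 0 = G\<close>, \<open>H (i + 1)\<close> = the \<open>i\<close>-th term of the
  lower central series of \<open>K\<close>, consists of normal subgroups of \<open>G\<close>, is therefore preserved by \<open>A\<close>,
  and reaches the trivial group after \<open>c + 1\<close> steps. Let \<open>N\<close> be the subgroup of those elements of
  \<open>A\<close> that act trivially on every factor \<open>H i / H (i + 1)\<close>.

  The quotient \<open>A/N\<close> is metabelian because the second derived subgroup of \<open>A\<close> lies in \<open>N\<close>. The
  reason is that on a module over a commutative ring, two endomorphisms that preserve all
  submodules commute: on a given \<open>m\<close> the first is multiplication by a scalar, and scalars commute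
  with the second (\<open>normal_preserving_endos_commute\<close>). On \<open>G/K\<close>, where conjugation is trivial,
  this applies to all normal automorphisms, so \<open>A'\<close> acts trivially on \<open>G/K\<close>. Since \<open>K\<close> centralises
  each later factor, that factor is a module over the commutative group ring of \<open>G/K\<close>, and the
  elements of \<open>A'\<close>, being trivial on \<open>G/K\<close>, are module endomorphisms. Hence they commute on it,
  and \<open>A''\<close> acts trivially.

  The group \<open>N\<close> is nilpotent of class at most \<open>c\<close> by the argument for stabilisers of normal
  series: with each commutator an automorphism moves elements one term deeper in the
  series (\<open>commutator_stabilizer\<close>), so that \<open>c\<close> commutators leave only the identity. As the series is
  central from \<open>H 1\<close> onwards, the displacements caused by two elements of \<open>N\<close> commute to the
  required depth, which makes this a direct computation.\<close>

section \<open>Commuting endomorphisms of an abelian normal subgroup\<close>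

lemma (in group) cancel_inv_left:
  assumes "x \<in> carrier G" "y \<in> carrier G"
  shows "inv x \<otimes> (x \<otimes> y) = y" and "x \<otimes> (inv x \<otimes> y) = y"
  using assms by (simp_all flip: m_assoc)

text \<open>Here \<open>M\<close> is a module for the commutative ring of operators generated by the conjugations, its
  submodules are normal subgroups of \<open>G\<close>, and \<open>\<phi>\<close>, \<open>\<psi>\<close> are module endomorphisms. The element
  \<open>\<psi> m\<close> lies in the submodule generated by \<open>m\<close>, so \<open>\<psi> m = s m\<close> for an operator \<open>s\<close>. Then \<open>\<psi>\<close> and \<open>s\<close>
  agree on that whole submodule, which contains \<open>\<phi> m\<close>, whence
  \<open>\<psi> (\<phi> m) = s (\<phi> m) = \<phi> (s m) = \<phi> (\<psi> m)\<close>.\<close>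

lemma (in group) normal_preserving_endos_commute:
  assumes M: "M \<lhd> G"
    and ab: "\<And>a b. a \<in> M \<Longrightarrow> b \<in> M \<Longrightarrow> a \<otimes> b = b \<otimes> a"
    and act: "\<And>g h m. g \<in> carrier G \<Longrightarrow> h \<in> carrier G \<Longrightarrow> m \<in> M \<Longrightarrow>
        g \<otimes> (h \<otimes> m \<otimes> inv h) \<otimes> inv g = h \<otimes> (g \<otimes> m \<otimes> inv g) \<otimes> inv h"
    and \<phi>: "\<phi> \<in> hom G G" "\<And>H. H \<lhd> G \<Longrightarrow> \<phi> ` H \<subseteq> H"
    and \<psi>: "\<psi> \<in> hom G G" "\<And>H. H \<lhd> G \<Longrightarrow> \<psi> ` H \<subseteq> H"
    and \<phi>_equi: "\<And>g m. g \<in> carrier G \<Longrightarrow> m \<in> M \<Longrightarrow>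
        \<phi> (g \<otimes> m \<otimes> inv g) = g \<otimes> \<phi> m \<otimes> inv g"
    and \<psi>_equi: "\<And>g m. g \<in> carrier G \<Longrightarrow> m \<in> M \<Longrightarrow>
        \<psi> (g \<otimes> m \<otimes> inv g) = g \<otimes> \<psi> m \<otimes> inv g"
    and m: "m \<in> M"
  shows "\<phi> (\<psi> m) = \<psi> (\<phi> m)"
proof -
  interpret M: normal M G by fact
  interpret \<phi>: group_hom G G \<phi>
    using \<phi>(1) by (simp add: group_hom.intro group_hom_axioms.intro is_group)
  interpret \<psi>: group_hom G G \<psi>
    using \<psi>(1) by (simp add: group_hom.intro group_hom_axioms.intro is_group)
  have \<phi>M: "\<phi> x \<in> M" if "x \<in> M" for x using \<phi>(2)[OF M] that by blast
  have Mc: "x \<in> carrier G" if "x \<in> M" for x using that M.subset by blast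
  \<comment> \<open>All module endomorphisms of \<open>M\<close> commuting with \<open>\<phi>\<close> serve as operators. They contain the
    conjugations and are closed under sums, so no group ring has to be constructed.\<close>
  define E where "E = {s. (\<forall>x\<in>M. s x \<in> M) \<and> (\<forall>x\<in>M. \<forall>y\<in>M. s (x \<otimes> y) = s x \<otimes> s y)
      \<and> (\<forall>g\<in>carrier G. \<forall>x\<in>M. s (g \<otimes> x \<otimes> inv g) = g \<otimes> s x \<otimes> inv g)
      \<and> (\<forall>x\<in>M. \<phi> (s x) = s (\<phi> x))}"
  have conj_mult: "g \<otimes> (a \<otimes> b) \<otimes> inv g = (g \<otimes> a \<otimes> inv g) \<otimes> (g \<otimes> b \<otimes> inv g)"
    if "g \<in> carrier G" "a \<in> carrier G" "b \<in> carrier G" for g a b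
    using that by (simp add: m_assoc cancel_inv_left)
  have conj_inv: "g \<otimes> inv a \<otimes> inv g = inv (g \<otimes> a \<otimes> inv g)"
    if "g \<in> carrier G" "a \<in> carrier G" for g a
    using that by (simp add: m_assoc inv_mult_group)
  have id_E: "(\<lambda>x. x) \<in> E"
    unfolding E_def by simp
  have inv_E: "(\<lambda>x. inv (s x)) \<in> E" if "s \<in> E" for s
    using that unfolding E_def by (simp add: conj_inv inv_mult_group ab Mc \<phi>M)
  have mult_E: "(\<lambda>x. s x \<otimes> t x) \<in> E" if "s \<in> E" "t \<in> E" for s t
  proof -
    have comm4: "(a \<otimes> b) \<otimes> (c \<otimes> d) = (a \<otimes> c) \<otimes> (b \<otimes> d)"
      if "a \<in> M" "b \<in> M" "c \<in> M" "d \<in> M" for a b c d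
      using that ab[of b c] by (metis M.mem_carrier m_assoc M.m_closed)
    show ?thesis using that unfolding E_def by (simp add: conj_mult comm4 Mc \<phi>M)
  qed
  have conj_E: "(\<lambda>x. h \<otimes> s x \<otimes> inv h) \<in> E" if "s \<in> E" "h \<in> carrier G" for s h
  proof -
    have "h \<otimes> s (x \<otimes> y) \<otimes> inv h = (h \<otimes> s x \<otimes> inv h) \<otimes> (h \<otimes> s y \<otimes> inv h)"
      if "x \<in> M" "y \<in> M" for x y
      using \<open>s \<in> E\<close> \<open>h \<in> carrier G\<close> that by (simp add: E_def conj_mult Mc)
    then show ?thesis
      using that unfolding E_def
      by (simp add: M.inv_op_closed2 \<phi>M \<phi>_equi act[of h] del: \<phi>.hom_mult)
  qed
  \<comment> \<open>The orbit of \<open>m\<close> is a normal subgroup containing \<open>m\<close>, hence contains \<open>\<psi> m\<close>.\<close>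
  have W: "(\<lambda>s. s m) ` E \<lhd> G"
  proof (rule normal_invI)
    show "subgroup ((\<lambda>s. s m) ` E) G"
    proof (rule subgroupI)
      show "(\<lambda>s. s m) ` E \<subseteq> carrier G" using m Mc by (auto simp: E_def)
      show "(\<lambda>s. s m) ` E \<noteq> {}" using id_E by blast
      show "inv a \<in> (\<lambda>s. s m) ` E" if "a \<in> (\<lambda>s. s m) ` E" for a
        using that inv_E by (auto simp: image_iff)
      show "a \<otimes> b \<in> (\<lambda>s. s m) ` E" if "a \<in> (\<lambda>s. s m) ` E" "b \<in> (\<lambda>s. s m) ` E" for a b
        using that by (auto intro: image_eqI[OF _ mult_E])
    qed
    show "x \<otimes> h \<otimes> inv x \<in> (\<lambda>s. s m) ` E"
      if "x \<in> carrier G" "h \<in> (\<lambda>s. s m) ` E" for x h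
      using that by (auto intro: image_eqI[OF _ conj_E])
  qed
  have "m \<in> (\<lambda>s. s m) ` E" using id_E by (rule rev_image_eqI) simp
  then have "\<psi> m \<in> (\<lambda>s. s m) ` E" using \<psi>(2)[OF W] by blast
  then obtain s where s: "s \<in> E" "\<psi> m = s m" by blast
  have sM: "s x \<in> M" if "x \<in> M" for x using s that by (auto simp: E_def)
  have s_mult: "s (x \<otimes> y) = s x \<otimes> s y" if "x \<in> M" "y \<in> M" for x y
    using s that by (auto simp: E_def)
  have s_one: "s \<one> = \<one>"
    using s_mult[of \<one> \<one>] sM[of \<one>] by (simp add: Mc)
  have s_inv: "s (inv x) = inv (s x)" if "x \<in> M" for x
  proof -
    have "s (inv x) \<otimes> s x = \<one>"
      using s_mult[of "inv x" x] that s_one by (simp add: Mc)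
    then show ?thesis using that sM Mc by (metis M.m_inv_closed inv_equality)
  qed
  \<comment> \<open>The equaliser of \<open>\<psi>\<close> and \<open>s\<close> is a normal subgroup containing \<open>m\<close>, hence contains \<open>\<phi> m\<close>.\<close>
  let ?D = "{x \<in> M. \<psi> x = s x}"
  have D: "?D \<lhd> G"
  proof (rule normal_invI)
    show "subgroup ?D G"
    proof (rule subgroupI)
      have "\<one> \<in> ?D" using s_one by simp
      then show "?D \<noteq> {}" by blast
      show "?D \<subseteq> carrier G" using M.subset by blast
      show "inv a \<in> ?D" if "a \<in> ?D" for a
        using that s_inv Mc by simp
      show "a \<otimes> b \<in> ?D" if "a \<in> ?D" "b \<in> ?D" for a b
        using that s_mult Mc by simp
    qed
    show "x \<otimes> h \<otimes> inv x \<in> ?D" if "x \<in> carrier G" "h \<in> ?D" for x h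
      using that s(1) by (simp add: E_def M.inv_op_closed2 \<psi>_equi del: \<psi>.hom_mult)
  qed
  have "\<phi> m \<in> ?D" using \<phi>(2)[OF D] m s(2) by blast
  then have "\<psi> (\<phi> m) = s (\<phi> m)" by simp
  also have "\<dots> = \<phi> (\<psi> m)" using s m by (simp add: E_def)
  finally show ?thesis ..
qed

section \<open>Normal automorphisms and congruences\<close>

lemma (in group) normal_auto_hom:
  assumes "f \<in> normal_auto G" shows "group_hom G G f"
  using assms by (simp add: normal_auto_def auto_def group_hom.intro group_hom_axioms.intro is_group)

lemma (in group) normal_auto_image: "f \<in> normal_auto G \<Longrightarrow> H \<lhd> G \<Longrightarrow> f ` H = H"
  by (simp add: normal_auto_def)

lemma (in group) normal_auto_mem: "f \<in> normal_auto G \<Longrightarrow> H \<lhd> G \<Longrightarrow> x \<in> H \<Longrightarrow> f x \<in> H"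
  using normal_auto_image by blast

lemma (in group) carrier_normal: "carrier G \<lhd> G"
  by (rule normal_invI) (auto simp: subgroup_self)

lemma (in group) normal_auto_closed: "f \<in> normal_auto G \<Longrightarrow> x \<in> carrier G \<Longrightarrow> f x \<in> carrier G"
  using normal_auto_mem carrier_normal by blast

lemma carrier_NormalAutoGroup [simp]: "carrier (NormalAutoGroup G) = normal_auto G"
  by (simp add: NormalAutoGroup_def)

lemma (in group) mult_NormalAutoGroup:
  assumes "f \<in> normal_auto G" "g \<in> normal_auto G" "x \<in> carrier G"
  shows "(f \<otimes>\<^bsub>NormalAutoGroup G\<^esub> g) x = f (g x)"
  using assms
  by (simp add: NormalAutoGroup_def AutoGroup_def BijGroup_def normal_auto_def auto_def compose_def)

lemma (in group) one_NormalAutoGroup: "x \<in> carrier G \<Longrightarrow> \<one>\<^bsub>NormalAutoGroup G\<^esub> x = x"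
  by (simp add: NormalAutoGroup_def AutoGroup_def BijGroup_def)

lemma (in group) NormalAutoGroup_one_iff:
  assumes "f \<in> normal_auto G"
  shows "f = \<one>\<^bsub>NormalAutoGroup G\<^esub> \<longleftrightarrow> (\<forall>x\<in>carrier G. f x = x)"
  using assms one_NormalAutoGroup
  by (auto simp: NormalAutoGroup_def AutoGroup_def BijGroup_def normal_auto_def auto_def Bij_def
      intro!: extensionalityI[of f "carrier G"])

lemma (in group) inv_NormalAutoGroup:
  assumes f: "f \<in> normal_auto G"
  shows "inv\<^bsub>NormalAutoGroup G\<^esub> f \<in> normal_auto G"
    and "x \<in> carrier G \<Longrightarrow> f ((inv\<^bsub>NormalAutoGroup G\<^esub> f) x) = x"
    and "x \<in> carrier G \<Longrightarrow> (inv\<^bsub>NormalAutoGroup G\<^esub> f) (f x) = x"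
proof -
  interpret A: group "NormalAutoGroup G" by (rule group_NormalAutoGroup)
  show inv: "inv\<^bsub>NormalAutoGroup G\<^esub> f \<in> normal_auto G"
    using A.inv_closed f by simp
  show "x \<in> carrier G \<Longrightarrow> f ((inv\<^bsub>NormalAutoGroup G\<^esub> f) x) = x"
    using mult_NormalAutoGroup[OF f inv] one_NormalAutoGroup A.r_inv f by simp
  show "x \<in> carrier G \<Longrightarrow> (inv\<^bsub>NormalAutoGroup G\<^esub> f) (f x) = x"
    using mult_NormalAutoGroup[OF inv f] one_NormalAutoGroup A.l_inv f by simp
qed

lemma (in group) normal_auto_image_coset:
  assumes f: "f \<in> normal_auto G" and V: "V \<lhd> G" and a: "a \<in> carrier G"
  shows "f ` (V #> a) = V #> f a"
proof -
  interpret f: group_hom G G f using f by (rule normal_auto_hom)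
  have Vc: "V \<subseteq> carrier G" using subgroup.subset[OF normal_imp_subgroup[OF V]] .
  have "f ` (V #> a) = f ` V #> f a"
    using a Vc by (force simp: r_coset_def image_iff)
  then show ?thesis using normal_auto_image[OF f V] by simp
qed

lemma (in group) normal_auto_cong:
  assumes "f \<in> normal_auto G" "V \<lhd> G" "a \<in> carrier G" "b \<in> carrier G" "V #> a = V #> b"
  shows "V #> f a = V #> f b"
  using assms normal_auto_image_coset by metis

text \<open>Normal subgroups of the quotient pull back to normal subgroups of \<open>G\<close>, so the map induced by a
  normal automorphism again preserves all of them.\<close>

lemma (in normal) image_endo_FactGroup:
  assumes f: "f \<in> normal_auto G"
  shows "(`) f \<in> hom (G Mod H) (G Mod H)"
    and "L \<lhd> G Mod H \<Longrightarrow> (`) f ` L \<subseteq> L"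
proof -
  interpret f: group_hom G G f using f by (rule normal_auto_hom)
  interpret q: group_hom G "G Mod H" "\<lambda>a. H #> a"
    by (simp add: group_hom.intro group_hom_axioms.intro is_group factorgroup_is_group r_coset_hom_Mod)
  have im: "f ` (H #> a) = H #> f a" if "a \<in> carrier G" for a
    using normal_auto_image_coset[OF f normal_axioms that] .
  show "(`) f \<in> hom (G Mod H) (G Mod H)"
    by (auto simp: hom_def carrier_FactGroup im simp flip: q.hom_mult simp del: q.hom_mult mult_FactGroup)
  assume L: "L \<lhd> G Mod H"
  interpret L: normal L "G Mod H" by fact
  let ?P = "{a \<in> carrier G. H #> a \<in> L}"
  have "?P \<lhd> G"
  proof (rule normal_invI)
    show "subgroup ?P G"
      using L.one_closed q.hom_one
      by (intro subgroupI) (auto simp del: mult_FactGroup one_FactGroup)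
    show "x \<otimes> h \<otimes> inv x \<in> ?P" if "x \<in> carrier G" "h \<in> ?P" for x h
      using that L.inv_op_closed2[of "H #> x" "H #> h"] by (auto simp del: mult_FactGroup)
  qed
  then have P: "f ` ?P = ?P" by (rule normal_auto_image[OF f])
  show "(`) f ` L \<subseteq> L"
  proof
    fix U assume "U \<in> (`) f ` L"
    then obtain Z where Z: "Z \<in> L" "U = f ` Z" by blast
    then obtain a where a: "a \<in> carrier G" "Z = H #> a"
      using L.subset by (auto simp: carrier_FactGroup)
    have "f a \<in> ?P" using P a Z by blast
    then show "U \<in> L" using Z a im by simp
  qed
qed

text \<open>The module argument applied to the image of \<open>U\<close> in the quotient by \<open>V\<close>. All congruences
  modulo \<open>V\<close> are written as equalities of cosets.\<close>

lemma (in group) normal_autos_commute_mod: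
  assumes U: "U \<lhd> G" and V: "V \<lhd> G"
    and ab: "\<And>a b. a \<in> U \<Longrightarrow> b \<in> U \<Longrightarrow> V #> (a \<otimes> b) = V #> (b \<otimes> a)"
    and act: "\<And>g h m. g \<in> carrier G \<Longrightarrow> h \<in> carrier G \<Longrightarrow> m \<in> U \<Longrightarrow>
        V #> (g \<otimes> (h \<otimes> m \<otimes> inv h) \<otimes> inv g) = V #> (h \<otimes> (g \<otimes> m \<otimes> inv g) \<otimes> inv h)"
    and A: "\<phi> \<in> normal_auto G" "\<psi> \<in> normal_auto G"
    and equi: "\<And>f g m. f \<in> {\<phi>, \<psi>} \<Longrightarrow> g \<in> carrier G \<Longrightarrow> m \<in> U \<Longrightarrow>
        V #> f (g \<otimes> m \<otimes> inv g) = V #> (g \<otimes> f m \<otimes> inv g)"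
    and m: "m \<in> U"
  shows "V #> \<phi> (\<psi> m) = V #> \<psi> (\<phi> m)"
proof -
  interpret U: normal U G by fact
  interpret V: normal V G by fact
  let ?Q = "G Mod V"
  interpret Q: group ?Q by (rule V.factorgroup_is_group)
  interpret q: group_hom G ?Q "\<lambda>a. V #> a"
    by (simp add: group_hom.intro group_hom_axioms.intro is_group V.factorgroup_is_group V.r_coset_hom_Mod)
  have Uc: "a \<in> carrier G" if "a \<in> U" for a
    using U.subset that by blast
  have UQ: "(\<lambda>a. V #> a) ` U \<lhd> ?Q"
    by (rule U.surj_hom_normal_subgroup[OF q.group_hom_axioms]) (simp add: carrier_FactGroup)
  have im: "f ` (V #> a) = V #> f a" if "f \<in> {\<phi>, \<psi>}" "a \<in> carrier G" for f a
    using normal_auto_image_coset[OF _ V] A that by blast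
  have conj_q: "(V #> g) \<otimes>\<^bsub>?Q\<^esub> (V #> a) \<otimes>\<^bsub>?Q\<^esub> inv\<^bsub>?Q\<^esub> (V #> g) = V #> (g \<otimes> a \<otimes> inv g)"
    if "g \<in> carrier G" "a \<in> carrier G" for g a
    using that by (simp del: mult_FactGroup)
  have closed: "f a \<in> carrier G" if "f \<in> {\<phi>, \<psi>}" "a \<in> carrier G" for f a
    using that A normal_auto_closed by blast
  have "\<phi> ` \<psi> ` (V #> m) = \<psi> ` \<phi> ` (V #> m)"
  proof (rule Q.normal_preserving_endos_commute[OF UQ, where \<phi> = "(`) \<phi>" and \<psi> = "(`) \<psi>"])
    show "(V #> m) \<in> (\<lambda>a. V #> a) ` U" using m by blast
    show "a \<otimes>\<^bsub>?Q\<^esub> b = b \<otimes>\<^bsub>?Q\<^esub> a" if "a \<in> (\<lambda>a. V #> a) ` U" "b \<in> (\<lambda>a. V #> a) ` U" for a b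
      using that ab by (auto simp flip: q.hom_mult simp del: q.hom_mult mult_FactGroup)
    show "g \<otimes>\<^bsub>?Q\<^esub> (h \<otimes>\<^bsub>?Q\<^esub> x \<otimes>\<^bsub>?Q\<^esub> inv\<^bsub>?Q\<^esub> h) \<otimes>\<^bsub>?Q\<^esub> inv\<^bsub>?Q\<^esub> g =
          h \<otimes>\<^bsub>?Q\<^esub> (g \<otimes>\<^bsub>?Q\<^esub> x \<otimes>\<^bsub>?Q\<^esub> inv\<^bsub>?Q\<^esub> g) \<otimes>\<^bsub>?Q\<^esub> inv\<^bsub>?Q\<^esub> h"
      if "g \<in> carrier ?Q" "h \<in> carrier ?Q" "x \<in> (\<lambda>a. V #> a) ` U" for g h x
      using that act by (auto simp: carrier_FactGroup conj_q simp del: q.hom_mult q.hom_inv mult_FactGroup)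
    have "f ` (g \<otimes>\<^bsub>?Q\<^esub> x \<otimes>\<^bsub>?Q\<^esub> inv\<^bsub>?Q\<^esub> g) = g \<otimes>\<^bsub>?Q\<^esub> f ` x \<otimes>\<^bsub>?Q\<^esub> inv\<^bsub>?Q\<^esub> g"
      if f: "f \<in> {\<phi>, \<psi>}" and g: "g \<in> carrier ?Q" and x: "x \<in> (\<lambda>a. V #> a) ` U" for f g x
    proof -
      obtain a where a: "a \<in> carrier G" "g = V #> a" using g by (auto simp: carrier_FactGroup)
      obtain b where b: "b \<in> U" "x = V #> b" using x by blast
      have "f ` (g \<otimes>\<^bsub>?Q\<^esub> x \<otimes>\<^bsub>?Q\<^esub> inv\<^bsub>?Q\<^esub> g) = V #> f (a \<otimes> b \<otimes> inv a)"
        unfolding a b using a b by (subst conj_q) (simp_all only: im[OF f] Uc m_closed inv_closed)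
      also have "\<dots> = V #> (a \<otimes> f b \<otimes> inv a)" by (rule equi[OF f a(1) b(1)])
      also have "\<dots> = g \<otimes>\<^bsub>?Q\<^esub> f ` x \<otimes>\<^bsub>?Q\<^esub> inv\<^bsub>?Q\<^esub> g"
        unfolding a b im[OF f Uc[OF b(1)]] by (rule conj_q[symmetric]) (use a b Uc closed[OF f] in auto)
      finally show ?thesis .
    qed
    then show "\<phi> ` (g \<otimes>\<^bsub>?Q\<^esub> x \<otimes>\<^bsub>?Q\<^esub> inv\<^bsub>?Q\<^esub> g) = g \<otimes>\<^bsub>?Q\<^esub> \<phi> ` x \<otimes>\<^bsub>?Q\<^esub> inv\<^bsub>?Q\<^esub> g"
      "\<psi> ` (g \<otimes>\<^bsub>?Q\<^esub> x \<otimes>\<^bsub>?Q\<^esub> inv\<^bsub>?Q\<^esub> g) = g \<otimes>\<^bsub>?Q\<^esub> \<psi> ` x \<otimes>\<^bsub>?Q\<^esub> inv\<^bsub>?Q\<^esub> g"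
      if "g \<in> carrier ?Q" "x \<in> (\<lambda>a. V #> a) ` U" for g x
      using that by blast+
  qed (use A V.image_endo_FactGroup in auto)
  then show ?thesis using m A im closed by simp
qed

section \<open>Automorphisms acting trivially on a section\<close>

definition section_stabilizer :: "('a, 'b) monoid_scheme \<Rightarrow> 'a set \<Rightarrow> 'a set \<Rightarrow> ('a \<Rightarrow> 'a) set"
  where "section_stabilizer G U V = {f \<in> normal_auto G. \<forall>x\<in>U. V #>\<^bsub>G\<^esub> f x = V #>\<^bsub>G\<^esub> x}"

lemma (in group) section_stabilizer_normal:
  assumes U: "U \<lhd> G" and V: "V \<lhd> G"
  shows "section_stabilizer G U V \<lhd> NormalAutoGroup G"
proof -
  let ?S = "section_stabilizer G U V" and ?A = "NormalAutoGroup G"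
  interpret A: group ?A by (rule group_NormalAutoGroup)
  have Uc: "x \<in> carrier G" if "x \<in> U" for x
    using subgroup.mem_carrier[OF normal_imp_subgroup[OF U] that] .
  have m_cl: "f \<otimes>\<^bsub>?A\<^esub> g \<in> normal_auto G" if "f \<in> normal_auto G" "g \<in> normal_auto G" for f g
    using A.m_closed that by simp
  have "subgroup ?S ?A"
  proof (rule A.subgroupI)
    show "?S \<subseteq> carrier ?A" by (auto simp: section_stabilizer_def)
    have "\<one>\<^bsub>?A\<^esub> \<in> ?S"
      using A.one_closed one_NormalAutoGroup Uc by (simp add: section_stabilizer_def)
    then show "?S \<noteq> {}" by blast
  next
    fix f assume "f \<in> ?S"
    then have f: "f \<in> normal_auto G" and fU: "\<And>x. x \<in> U \<Longrightarrow> V #> f x = V #> x"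
      by (auto simp: section_stabilizer_def)
    note i = inv_NormalAutoGroup[OF f]
    show "inv\<^bsub>?A\<^esub> f \<in> ?S"
      using i(1) fU[OF normal_auto_mem[OF i(1) U]] i(2) Uc by (auto simp: section_stabilizer_def)
  next
    fix f g assume "f \<in> ?S" "g \<in> ?S"
    then show "f \<otimes>\<^bsub>?A\<^esub> g \<in> ?S"
      using normal_auto_mem[OF _ U] Uc m_cl
      by (auto simp: section_stabilizer_def mult_NormalAutoGroup)
  qed
  then show ?thesis
  proof (rule A.normal_invI)
    fix f s assume "f \<in> carrier ?A" and "s \<in> ?S"
    then have f: "f \<in> normal_auto G" and s: "s \<in> normal_auto G"
      and sU: "\<And>x. x \<in> U \<Longrightarrow> V #> s x = V #> x"
      by (auto simp: section_stabilizer_def)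
    note i = inv_NormalAutoGroup[OF f]
    have "V #> (f \<otimes>\<^bsub>?A\<^esub> s \<otimes>\<^bsub>?A\<^esub> inv\<^bsub>?A\<^esub> f) x = V #> x" if x: "x \<in> U" for x
    proof -
      let ?y = "(inv\<^bsub>?A\<^esub> f) x"
      have y: "?y \<in> U" using normal_auto_mem[OF i(1) U x] .
      have "V #> f (s ?y) = V #> f ?y"
        using normal_auto_cong[OF f V] sU[OF y] Uc[OF y] normal_auto_closed[OF s] by blast
      then show ?thesis
        using x y f s i m_cl Uc normal_auto_closed by (simp add: mult_NormalAutoGroup)
    qed
    then show "f \<otimes>\<^bsub>?A\<^esub> s \<otimes>\<^bsub>?A\<^esub> inv\<^bsub>?A\<^esub> f \<in> ?S"
      using f s i(1) m_cl by (simp add: section_stabilizer_def)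
  qed
qed

text \<open>Two automorphisms that commute modulo \<open>V\<close> on \<open>U\<close> have a commutator acting trivially there:
  apply the congruence to the preimage of \<open>x\<close> under \<open>g \<circ> f\<close>, which lies in \<open>U\<close> as well.\<close>

lemma (in group) commutator_in_section_stabilizer:
  assumes U: "U \<lhd> G" and f: "f \<in> normal_auto G" and g: "g \<in> normal_auto G"
    and comm: "\<And>x. x \<in> U \<Longrightarrow> V #> f (g x) = V #> g (f x)"
  shows "f \<otimes>\<^bsub>NormalAutoGroup G\<^esub> g \<otimes>\<^bsub>NormalAutoGroup G\<^esub> inv\<^bsub>NormalAutoGroup G\<^esub> f
      \<otimes>\<^bsub>NormalAutoGroup G\<^esub> inv\<^bsub>NormalAutoGroup G\<^esub> g \<in> section_stabilizer G U V"
proof -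
  let ?A = "NormalAutoGroup G"
  interpret A: group ?A by (rule group_NormalAutoGroup)
  have Uc: "x \<in> carrier G" if "x \<in> U" for x
    using subgroup.mem_carrier[OF normal_imp_subgroup[OF U] that] .
  have m_cl: "f \<otimes>\<^bsub>?A\<^esub> g \<in> normal_auto G" if "f \<in> normal_auto G" "g \<in> normal_auto G" for f g
    using A.m_closed that by simp
  note i = inv_NormalAutoGroup[OF f] and j = inv_NormalAutoGroup[OF g]
  have "V #> (f \<otimes>\<^bsub>?A\<^esub> g \<otimes>\<^bsub>?A\<^esub> inv\<^bsub>?A\<^esub> f \<otimes>\<^bsub>?A\<^esub> inv\<^bsub>?A\<^esub> g) x = V #> x" if x: "x \<in> U" for x
  proof -
    let ?y = "(inv\<^bsub>?A\<^esub> f) ((inv\<^bsub>?A\<^esub> g) x)"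
    have y: "?y \<in> U" using normal_auto_mem[OF _ U] i(1) j(1) x by blast
    have "V #> (f \<otimes>\<^bsub>?A\<^esub> g \<otimes>\<^bsub>?A\<^esub> inv\<^bsub>?A\<^esub> f \<otimes>\<^bsub>?A\<^esub> inv\<^bsub>?A\<^esub> g) x = V #> f (g ?y)"
      using x f g i j m_cl Uc normal_auto_closed by (simp add: mult_NormalAutoGroup)
    also have "\<dots> = V #> g (f ?y)" by (rule comm[OF y])
    also have "\<dots> = V #> x" using x Uc i j normal_auto_closed by simp
    finally show ?thesis .
  qed
  then show ?thesis using f g i(1) j(1) m_cl by (simp add: section_stabilizer_def)
qed

section \<open>The lower central series of a normal subgroup\<close>

lemma (in group) lower_central_is_subgroup: "subgroup (lower_central G n) G"
proof (induction n)
  case 0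
  then show ?case by (simp add: subgroup_self)
next
  case (Suc n)
  have "x \<in> carrier G" if "x \<in> lower_central G n" for x
    using subgroup.mem_carrier[OF Suc that] .
  then show ?case
    unfolding lower_central.simps by (intro generate_is_subgroup) auto
qed

text \<open>Lets the lower central series of a subgroup be computed with the operations and the generation
  of the ambient group.\<close>

lemma (in group) lower_central_Suc_subgroup:
  assumes K: "subgroup K G"
  shows "lower_central (G\<lparr>carrier := K\<rparr>) (Suc n) = generate G
    (\<Union>x \<in> lower_central (G\<lparr>carrier := K\<rparr>) n. \<Union>y \<in> K. {x \<otimes> y \<otimes> inv x \<otimes> inv y})"
proof -
  interpret K: group "G\<lparr>carrier := K\<rparr>" using K by (rule subgroup_imp_group)
  interpret K': subgroup K G by fact
  have LK: "x \<in> K" if "x \<in> lower_central (G\<lparr>carrier := K\<rparr>) n" for x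
    using subgroup.mem_carrier[OF K.lower_central_is_subgroup that] by simp
  have "(\<Union>x \<in> lower_central (G\<lparr>carrier := K\<rparr>) n. \<Union>y \<in> K. {x \<otimes> y \<otimes> inv x \<otimes> inv y}) \<subseteq> K"
    using LK by auto
  then show ?thesis
    using LK K by (simp add: generate_consistent m_inv_consistent)
qed

lemma (in normal) lower_central_normal: "lower_central (G\<lparr>carrier := H\<rparr>) n \<lhd> G"
proof (induction n)
  case 0
  then show ?case by (simp add: normal_axioms)
next
  case (Suc n)
  let ?L = "lower_central (G\<lparr>carrier := H\<rparr>) n"
  interpret L: normal ?L G by fact
  let ?C = "\<Union>x \<in> ?L. \<Union>y \<in> H. {x \<otimes> y \<otimes> inv x \<otimes> inv y}"
  have "generate G ?C \<lhd> G"
  proof (rule normal_generateI)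
    show "?C \<subseteq> carrier G" using L.subset subset by auto
    fix h g assume "h \<in> ?C" and g: "g \<in> carrier G"
    then obtain x y where x: "x \<in> ?L" and y: "y \<in> H" and h: "h = x \<otimes> y \<otimes> inv x \<otimes> inv y" by blast
    let ?x = "g \<otimes> x \<otimes> inv g" and ?y = "g \<otimes> y \<otimes> inv g"
    have "g \<otimes> h \<otimes> inv g = ?x \<otimes> ?y \<otimes> inv ?x \<otimes> inv ?y"
      using x y g h by (simp add: m_assoc inv_mult_group cancel_inv_left)
    moreover have "?x \<in> ?L" "?y \<in> H"
      using x y g L.inv_op_closed2 inv_op_closed2 by auto
    ultimately show "g \<otimes> h \<otimes> inv g \<in> ?C" by blast
  qed
  then show ?case unfolding lower_central_Suc_subgroup[OF subgroup_axioms] .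
qed

section \<open>Abelian-by-central series\<close>

locale abelian_by_central_series = group +
  fixes H :: "nat \<Rightarrow> 'a set"
  assumes normal: "\<And>i. H i \<lhd> G"
    and zero: "H 0 = carrier G"
    and decreasing: "\<And>i. H (Suc i) \<subseteq> H i"
    and abelian: "\<And>x y. x \<in> carrier G \<Longrightarrow> y \<in> carrier G \<Longrightarrow>
        H 1 #> (x \<otimes> y) = H 1 #> (y \<otimes> x)"
    and central: "\<And>i x y. x \<in> H (Suc i) \<Longrightarrow> y \<in> H 1 \<Longrightarrow>
        H (Suc (Suc i)) #> (x \<otimes> y) = H (Suc (Suc i)) #> (y \<otimes> x)"
begin

lemma closed: "x \<in> H i \<Longrightarrow> x \<in> carrier G"
  by (rule subgroup.mem_carrier[OF normal_imp_subgroup[OF normal]])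

lemma sub_one: "H (Suc i) \<subseteq> H 1"
  by (induction i) (use decreasing in auto)

lemma coset_mult:
  "x \<in> carrier G \<Longrightarrow> y \<in> carrier G \<Longrightarrow> H i #> (x \<otimes> y) = (H i #> x) <#> (H i #> y)"
  using normal.rcos_sum[OF normal] by simp

lemma coset_eq_iff:
  assumes "x \<in> carrier G" "y \<in> carrier G"
  shows "H i #> x = H i #> y \<longleftrightarrow> x \<otimes> inv y \<in> H i"
proof -
  interpret N: normal "H i" G by (rule normal)
  show ?thesis
    using assms by (metis N.rcos_module N.subgroup_axioms is_group repr_independenceD repr_independence
        rcos_self)
qed

lemma conj_mod:
  assumes z: "z \<in> H 1" and m: "m \<in> H (Suc i)"
  shows "H (Suc (Suc i)) #> (z \<otimes> m \<otimes> inv z) = H (Suc (Suc i)) #> m"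
proof -
  have c: "z \<in> carrier G" "m \<in> carrier G" using z m closed by auto
  have "H (Suc (Suc i)) #> (z \<otimes> m \<otimes> inv z) = H (Suc (Suc i)) #> (m \<otimes> z \<otimes> inv z)"
    using central[OF m z] c by (simp add: coset_mult)
  then show ?thesis using c by (simp add: m_assoc)
qed

text \<open>Conjugation is trivial on the abelian group \<open>G / H 1\<close>, so every endomorphism commutes with it
  and all normal automorphisms commute there.\<close>

lemma commutator_trivial_on_top:
  assumes "f \<in> normal_auto G" "g \<in> normal_auto G"
  shows "f \<otimes>\<^bsub>NormalAutoGroup G\<^esub> g \<otimes>\<^bsub>NormalAutoGroup G\<^esub> inv\<^bsub>NormalAutoGroup G\<^esub> f
      \<otimes>\<^bsub>NormalAutoGroup G\<^esub> inv\<^bsub>NormalAutoGroup G\<^esub> g \<in> section_stabilizer G (carrier G) (H 1)"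
proof (rule commutator_in_section_stabilizer[OF carrier_normal assms])
  fix x assume x: "x \<in> carrier G"
  have conj: "H 1 #> (a \<otimes> b \<otimes> inv a) = H 1 #> b" if "a \<in> carrier G" "b \<in> carrier G" for a b
    using that abelian[of "a \<otimes> b" "inv a"] by (simp add: m_assoc[symmetric])
  show "H 1 #> f (g x) = H 1 #> g (f x)"
  proof (rule normal_autos_commute_mod[OF carrier_normal normal])
    show "H 1 #> k (a \<otimes> b \<otimes> inv a) = H 1 #> (a \<otimes> k b \<otimes> inv a)"
      if "k \<in> {f, g}" "a \<in> carrier G" "b \<in> carrier G" for k a b
    proof -
      have k: "k \<in> normal_auto G" using that(1) assms by blast
      have "H 1 #> k (a \<otimes> b \<otimes> inv a) = H 1 #> k b"
        by (rule normal_auto_cong[OF k normal]) (use that conj in auto)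
      then show ?thesis using conj that normal_auto_closed[OF k] by simp
    qed
  qed (use assms x abelian conj in auto)
qed

text \<open>A later factor is a module over the group ring of the abelian group \<open>G / H 1\<close>. An automorphism
  acting trivially on \<open>G / H 1\<close> does not change the operator by which an element of \<open>G\<close> acts, so it
  is an endomorphism of this module.\<close>

lemma commutator_trivial_below:
  assumes f: "f \<in> section_stabilizer G (carrier G) (H 1)"
    and g: "g \<in> section_stabilizer G (carrier G) (H 1)"
  shows "f \<otimes>\<^bsub>NormalAutoGroup G\<^esub> g \<otimes>\<^bsub>NormalAutoGroup G\<^esub> inv\<^bsub>NormalAutoGroup G\<^esub> f
      \<otimes>\<^bsub>NormalAutoGroup G\<^esub> inv\<^bsub>NormalAutoGroup G\<^esub> g
      \<in> section_stabilizer G (H (Suc i)) (H (Suc (Suc i)))"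
proof -
  let ?U = "H (Suc i)" and ?V = "H (Suc (Suc i))"
  have A: "f \<in> normal_auto G" "g \<in> normal_auto G"
    using f g by (auto simp: section_stabilizer_def)
  \<comment> \<open>\<open>a\<close> and \<open>b\<close> differ by an element of \<open>H 1\<close>, which centralises the factor.\<close>
  have act_cong: "?V #> (a \<otimes> m \<otimes> inv a) = ?V #> (b \<otimes> m \<otimes> inv b)"
    if "a \<in> carrier G" "b \<in> carrier G" "H 1 #> a = H 1 #> b" "m \<in> ?U" for a b m
  proof -
    let ?z = "a \<otimes> inv b" and ?n = "b \<otimes> m \<otimes> inv b"
    have mc: "m \<in> carrier G" using that closed by blast
    have z: "?z \<in> H 1" using that coset_eq_iff by blast
    have n: "?n \<in> ?U" using that normal.inv_op_closed2[OF normal] by blast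
    have "?z \<otimes> ?n \<otimes> inv ?z = a \<otimes> m \<otimes> inv a"
      using that mc by (simp add: inv_mult_group m_assoc cancel_inv_left)
    then show ?thesis using conj_mod[OF z n] by simp
  qed
  show ?thesis
  proof (rule commutator_in_section_stabilizer[OF normal A])
    fix x assume x: "x \<in> ?U"
    show "?V #> f (g x) = ?V #> g (f x)"
    proof (rule normal_autos_commute_mod[OF normal normal])
      show "?V #> (a \<otimes> b) = ?V #> (b \<otimes> a)" if "a \<in> ?U" "b \<in> ?U" for a b
        using central that sub_one by blast
      show "?V #> (a \<otimes> (b \<otimes> m \<otimes> inv b) \<otimes> inv a) = ?V #> (b \<otimes> (a \<otimes> m \<otimes> inv a) \<otimes> inv b)"
        if "a \<in> carrier G" "b \<in> carrier G" "m \<in> ?U" for a b m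
        using act_cong[of "a \<otimes> b" "b \<otimes> a" m] abelian that closed[of m]
        by (simp add: inv_mult_group m_assoc)
      show "?V #> k (a \<otimes> m \<otimes> inv a) = ?V #> (a \<otimes> k m \<otimes> inv a)"
        if k: "k \<in> {f, g}" and "a \<in> carrier G" "m \<in> ?U" for k a m
      proof -
        have k': "k \<in> normal_auto G" "H 1 #> k a = H 1 #> a"
          using k f g that by (auto simp: section_stabilizer_def)
        interpret k: group_hom G G k using k'(1) by (rule normal_auto_hom)
        have "k (a \<otimes> m \<otimes> inv a) = k a \<otimes> k m \<otimes> inv (k a)"
          using that closed by simp
        then show ?thesis
          using act_cong[of "k a" a "k m"] k' that normal_auto_mem[OF k'(1) normal] by simp
      qed
    qed (use A x in auto)
  qed
qed

text \<open>The index counts the extra depth: \<open>stabilizer 0\<close> is the stabiliser of the series, and elements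
  of \<open>stabilizer j\<close> move \<open>H i\<close> only within cosets of a term that lies \<open>j\<close> steps below \<open>H (i + 1)\<close>.\<close>

definition stabilizer :: "nat \<Rightarrow> ('a \<Rightarrow> 'a) set"
  where "stabilizer j = (\<Inter>i. section_stabilizer G (H i) (H (Suc (i + j))))"

lemma stabilizer_subgroup: "subgroup (stabilizer j) (NormalAutoGroup G)"
proof -
  interpret A: group "NormalAutoGroup G" by (rule group_NormalAutoGroup)
  show ?thesis unfolding stabilizer_def
    by (rule A.subgroups_Inter)
      (auto intro: normal_imp_subgroup section_stabilizer_normal normal)
qed

lemma stabilizer_normal: "stabilizer j \<lhd> NormalAutoGroup G"
proof -
  interpret A: group "NormalAutoGroup G" by (rule group_NormalAutoGroup)
  show ?thesis
  proof (rule A.normal_invI[OF stabilizer_subgroup])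
    fix f s assume "f \<in> carrier (NormalAutoGroup G)" "s \<in> stabilizer j"
    then show "f \<otimes>\<^bsub>NormalAutoGroup G\<^esub> s \<otimes>\<^bsub>NormalAutoGroup G\<^esub> inv\<^bsub>NormalAutoGroup G\<^esub> f \<in> stabilizer j"
      using normal.inv_op_closed2[OF section_stabilizer_normal[OF normal normal]]
      unfolding stabilizer_def by blast
  qed
qed

text \<open>The first factor is already handled by the first derived subgroup, and this is what makes its
  elements equivariant on the remaining factors.\<close>

lemma second_derived_stabilizes:
  "(derived (NormalAutoGroup G) ^^ 2) (carrier (NormalAutoGroup G)) \<subseteq> stabilizer 0"
proof -
  let ?A = "NormalAutoGroup G"
  interpret A: group ?A by (rule group_NormalAutoGroup)
  let ?A1 = "derived ?A (carrier ?A)"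
  have top: "?A1 \<subseteq> section_stabilizer G (carrier G) (H 1)"
    unfolding derived_def
    using commutator_trivial_on_top
      normal_imp_subgroup[OF section_stabilizer_normal[OF carrier_normal normal]]
    by (intro A.generate_subgroup_incl) auto
  have "derived ?A ?A1 \<subseteq> section_stabilizer G (H i) (H (Suc i))" for i
  proof (cases i)
    case 0
    have "derived ?A ?A1 \<subseteq> ?A1"
      using A.derived_incl[OF subset_refl A.derived_is_subgroup] by simp
    then show ?thesis using top 0 by (simp add: zero)
  next
    case (Suc k)
    then show ?thesis
      unfolding derived_def[of _ ?A1]
      using commutator_trivial_below top
        normal_imp_subgroup[OF section_stabilizer_normal[OF normal normal]]
      by (intro A.generate_subgroup_incl) (auto simp: subset_iff)
  qed
  then show ?thesis by (auto simp: stabilizer_def numeral_2_eq_2)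
qed

text \<open>Write \<open>f x = a x\<close> and \<open>g x = b x\<close>. Since \<open>f\<close> fixes \<open>b\<close> and \<open>g\<close> fixes \<open>a\<close> modulo the target term,
  \<open>f (g x)\<close> is congruent to \<open>b a x\<close> and \<open>g (f x)\<close> to \<open>a b x\<close>; and \<open>a\<close>, \<open>b\<close> commute modulo
  that term because the series is central below \<open>H 1\<close>, which contains \<open>b\<close>.\<close>

lemma commutator_stabilizer:
  assumes f: "f \<in> stabilizer j" and g: "g \<in> stabilizer 0"
  shows "f \<otimes>\<^bsub>NormalAutoGroup G\<^esub> g \<otimes>\<^bsub>NormalAutoGroup G\<^esub> inv\<^bsub>NormalAutoGroup G\<^esub> f
      \<otimes>\<^bsub>NormalAutoGroup G\<^esub> inv\<^bsub>NormalAutoGroup G\<^esub> g \<in> stabilizer (Suc j)"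
proof -
  have A: "f \<in> normal_auto G" "g \<in> normal_auto G"
    using f g by (auto simp: section_stabilizer_def stabilizer_def)
  have fS: "H (Suc (i + j)) #> f x = H (Suc (i + j)) #> x" if "x \<in> H i" for i x
    using f that by (auto simp: section_stabilizer_def stabilizer_def)
  have gS: "H (Suc i) #> g x = H (Suc i) #> x" if "x \<in> H i" for i x
    using g that by (auto simp: section_stabilizer_def stabilizer_def)
  interpret f: group_hom G G f using A(1) by (rule normal_auto_hom)
  interpret g: group_hom G G g using A(2) by (rule normal_auto_hom)
  have "H (Suc (Suc (i + j))) #> f (g x) = H (Suc (Suc (i + j))) #> g (f x)" (is "?V #> _ = _")
    if x: "x \<in> H i" for i x
  proof -
    have xc: "x \<in> carrier G" using x closed by blast
    define a b where "a = f x \<otimes> inv x" and "b = g x \<otimes> inv x"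
    have a: "a \<in> H (Suc (i + j))" using fS[OF x] coset_eq_iff xc by (simp add: a_def)
    have b: "b \<in> H (Suc i)" using gS[OF x] coset_eq_iff xc by (simp add: b_def)
    have fx: "f x = a \<otimes> x" and gx: "g x = b \<otimes> x"
      using xc by (simp_all add: m_assoc a_def b_def)
    have c: "a \<in> carrier G" "b \<in> carrier G" using a b closed by blast+
    have fb: "?V #> f b = ?V #> b" using fS[OF b] by simp
    have ga: "?V #> g a = ?V #> a" using gS[OF a] by simp
    have "b \<in> H 1" using b sub_one by blast
    then have ab: "?V #> (a \<otimes> b) = ?V #> (b \<otimes> a)" by (rule central[OF a])
    have "?V #> f (g x) = (?V #> f b) <#> (?V #> f x)"
      unfolding gx using xc c by (simp add: coset_mult)
    also have "\<dots> = ?V #> (b \<otimes> a \<otimes> x)"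
      unfolding fb fx using xc c by (simp add: coset_mult[symmetric] m_assoc)
    also have "\<dots> = ?V #> (a \<otimes> b \<otimes> x)"
      using ab xc c coset_mult[of "a \<otimes> b" x] coset_mult[of "b \<otimes> a" x] by simp
    also have "\<dots> = (?V #> g a) <#> (?V #> g x)"
      unfolding ga gx using xc c by (simp add: coset_mult[symmetric] m_assoc)
    also have "\<dots> = ?V #> g (f x)"
      unfolding fx using xc c by (simp add: coset_mult)
    finally show ?thesis .
  qed
  then show ?thesis
    using commutator_in_section_stabilizer[OF normal A] by (simp add: stabilizer_def)
qed

lemma lower_central_stabilizer:
  "lower_central ((NormalAutoGroup G)\<lparr>carrier := stabilizer 0\<rparr>) j \<subseteq> stabilizer j"
proof (induction j)
  case 0
  then show ?case by simp
next
  case (Suc j)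
  interpret A: group "NormalAutoGroup G" by (rule group_NormalAutoGroup)
  show ?case
    unfolding A.lower_central_Suc_subgroup[OF stabilizer_subgroup]
    by (rule A.generate_subgroup_incl[OF _ stabilizer_subgroup])
      (use Suc commutator_stabilizer in blast)
qed

lemma stabilizer_eq_one:
  assumes "H (Suc j) = {\<one>}"
  shows "stabilizer j = {\<one>\<^bsub>NormalAutoGroup G\<^esub>}"
proof
  show "{\<one>\<^bsub>NormalAutoGroup G\<^esub>} \<subseteq> stabilizer j"
    using subgroup.one_closed[OF stabilizer_subgroup] by simp
  show "stabilizer j \<subseteq> {\<one>\<^bsub>NormalAutoGroup G\<^esub>}"
  proof
    fix f assume f: "f \<in> stabilizer j"
    then have "f \<in> section_stabilizer G (H 0) (H (Suc (0 + j)))"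
      unfolding stabilizer_def by blast
    then have f: "f \<in> normal_auto G" "\<forall>x\<in>carrier G. {\<one>} #> f x = {\<one>} #> x"
      by (auto simp: section_stabilizer_def assms zero)
    then have "f x = x" if "x \<in> carrier G" for x
      using that normal_auto_closed by (auto simp: r_coset_def)
    then show "f \<in> {\<one>\<^bsub>NormalAutoGroup G\<^esub>}" using NormalAutoGroup_one_iff f(1) by blast
  qed
qed

lemma nilpotent_stabilizer:
  assumes "H (Suc c) = {\<one>}"
  shows "nilpotent_group ((NormalAutoGroup G)\<lparr>carrier := stabilizer 0\<rparr>)" (is "nilpotent_group ?N")
    and "nilpotency_class ((NormalAutoGroup G)\<lparr>carrier := stabilizer 0\<rparr>) \<le> c"
proof -
  interpret A: group "NormalAutoGroup G" by (rule group_NormalAutoGroup)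
  have N: "group ?N" using A.subgroup_imp_group[OF stabilizer_subgroup] .
  have "lower_central ?N c = {\<one>\<^bsub>?N\<^esub>}"
    using lower_central_stabilizer[of c] stabilizer_eq_one[OF assms]
      subgroup.one_closed[OF group.lower_central_is_subgroup[OF N], of c] by auto
  then show "nilpotent_group ?N" "nilpotency_class ?N \<le> c"
    using N by (auto simp: nilpotent_group_def nilpotency_class_def intro: Least_le)
qed

end

section \<open>Groups that are nilpotent-by-abelian\<close>

lemma (in normal) metabelian_FactGroup:
  assumes "(derived G ^^ 2) (carrier G) \<subseteq> H"
  shows "metabelian (G Mod H)"
proof -
  interpret Q: group "G Mod H" by (rule factorgroup_is_group)
  interpret q: group_hom G "G Mod H" "\<lambda>a. H #> a"
    by (simp add: group_hom.intro group_hom_axioms.intro is_group factorgroup_is_group r_coset_hom_Mod)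
  have "(derived (G Mod H) ^^ 2) (carrier (G Mod H)) = (\<lambda>a. H #> a) ` (derived G ^^ 2) (carrier G)"
    using q.exp_of_derived_img[of "carrier G" 2] by (simp add: carrier_FactGroup)
  also have "\<dots> \<subseteq> {H}" using assms rcos_const by (auto simp: is_group)
  finally have "(derived (G Mod H) ^^ 2) (carrier (G Mod H)) = {\<one>\<^bsub>G Mod H\<^esub>}"
    using subgroup.one_closed[OF Q.exp_of_derived_is_subgroup[OF Q.subgroup_self], of 2] by auto
  then show ?thesis
    unfolding metabelian_def derived_length_def
    using Q.solvable_iff_trivial_derived_seq Q.is_group by (blast intro: Least_le)
qed

text \<open>Placing \<open>G\<close> on top shifts the index by one, so that a subgroup of class \<open>c\<close> gives a series
  reaching the trivial group at index \<open>c + 1\<close>.\<close>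

lemma (in normal) abelian_by_central_series_lower_central:
  assumes ab: "comm_group (G Mod H)"
  shows "abelian_by_central_series G
    (\<lambda>i. case i of 0 \<Rightarrow> carrier G | Suc k \<Rightarrow> lower_central (G\<lparr>carrier := H\<rparr>) k)"
proof -
  let ?L = "lower_central (G\<lparr>carrier := H\<rparr>)"
  interpret Q: comm_group "G Mod H" by fact
  have L: "?L k \<lhd> G" for k by (rule lower_central_normal)
  have LH: "?L k \<subseteq> H" for k
    using group.lower_central_is_subgroup[OF subgroup_imp_group[OF subgroup_axioms]]
      subgroup.subset by fastforce
  have comm: "x \<otimes> y \<otimes> inv x \<otimes> inv y \<in> ?L (Suc k)" if "x \<in> ?L k" "y \<in> H" for x y k
    unfolding lower_central_Suc_subgroup[OF subgroup_axioms] using that by (blast intro: generate.incl)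
  show ?thesis
  proof (intro abelian_by_central_series.intro abelian_by_central_series_axioms.intro is_group, goal_cases)
    case (1 i)
    then show ?case using L carrier_normal by (simp split: nat.split)
  next
    case 2
    then show ?case by simp
  next
    case (3 i)
    show ?case
    proof (cases i)
      case 0
      then show ?thesis using subset by simp
    next
      case (Suc k)
      interpret Lk: normal "?L k" G by (rule L)
      have "x \<otimes> y \<otimes> inv x \<otimes> inv y \<in> ?L k" if x: "x \<in> ?L k" and y: "y \<in> H" for x y
      proof -
        have c: "x \<in> carrier G" "y \<in> carrier G" using x y subset by auto
        have "x \<otimes> (y \<otimes> inv x \<otimes> inv y) \<in> ?L k" using x c Lk.inv_op_closed2 by blast
        then show ?thesis using c by (simp add: m_assoc)
      qed
      then have "?L (Suc k) \<subseteq> ?L k"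
        unfolding lower_central_Suc_subgroup[OF subgroup_axioms]
        by (intro generate_subgroup_incl) (auto intro: Lk.subgroup_axioms)
      then show ?thesis using Suc by simp
    qed
  next
    case (4 x y)
    then show ?case
      using Q.m_comm[of "H #> x" "H #> y"] by (simp add: carrier_FactGroup rcos_sum)
  next
    case (5 i x y)
    then have xy: "x \<in> ?L i" "y \<in> H" by auto
    then have c: "x \<in> carrier G" "y \<in> carrier G" using LH[of i] subset by auto
    have "x \<otimes> y = (x \<otimes> y \<otimes> inv x \<otimes> inv y) \<otimes> (y \<otimes> x)"
      using c by (simp add: m_assoc cancel_inv_left)
    then have "x \<otimes> y \<in> ?L (Suc i) #> (y \<otimes> x)" using comm[OF xy] by (auto simp: r_coset_def)
    then have "?L (Suc i) #> (y \<otimes> x) = ?L (Suc i) #> (x \<otimes> y)"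
      using c by (intro repr_independence normal_imp_subgroup L) auto
    then show ?case by (simp del: lower_central.simps)
  qed
qed

theorem theorem1:
  fixes G :: "('a, 'b) monoid_scheme" and c :: nat
  assumes "group G"
    and "by_group (\<lambda>N. nilpotent_group N \<and> nilpotency_class N = c) comm_group G"
  shows "by_group (\<lambda>N. nilpotent_group N \<and> nilpotency_class N \<le> c) metabelian (NormalAutoGroup G)"
proof -
  obtain K where K: "K \<lhd> G" and nil: "nilpotent_group (G\<lparr>carrier := K\<rparr>)"
    and cl: "nilpotency_class (G\<lparr>carrier := K\<rparr>) = c" and ab: "comm_group (G Mod K)"
    using assms(2) by (auto simp: by_group_def)
  interpret K: normal K G by fact
  let ?L = "lower_central (G\<lparr>carrier := K\<rparr>)"
  interpret S: abelian_by_central_series G "\<lambda>i. case i of 0 \<Rightarrow> carrier G | Suc k \<Rightarrow> ?L k"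
    using ab by (rule K.abelian_by_central_series_lower_central)
  have "?L c = {\<one>\<^bsub>G\<^esub>}"
    using nil cl LeastI_ex[of "\<lambda>n. ?L n = {\<one>\<^bsub>G\<^esub>}"]
    by (auto simp: nilpotent_group_def nilpotency_class_def)
  then show ?thesis
    unfolding by_group_def
    using K.group_NormalAutoGroup S.stabilizer_normal S.nilpotent_stabilizer[of c]
      normal.metabelian_FactGroup[OF S.stabilizer_normal S.second_derived_stabilizes]
    by auto
qed

end
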